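(* If $X$ is a non-discrete metrizable space, then the free locally convex space $L(X)$ over $X$ is $c_0$-quasibarrelled but it is neither $c_0$-barrelled nor $\ell_\infty$-quasibarrelled.
   Context: Locally convex spaces (lcs) are real and Hausdorff; Tychonoff means completely regular and Hausdorff. The free locally convex space over a Tychonoff space $X$ is an lcs $L(X)$ with a continuous map $i:X\to L(X)$ such that for every continuous map $f$ from $X$ to an lcs $E$ there is a unique continuous linear operator $\bar f:L(X)\to E$ with $f=\bar f\circ i$. It exists and is essentially unique, and $i$ is a topological embedding whose image is a Hamel basis of $L(X)$. For an lcs $E$ with dual $E'$, $\sigma(E',E)$ is the weak-$*$ topology and $\beta(E',E)$ the strong topology (uniform convergence on bounded subsets of $E$). A subset of $E'$ is equicontinuous if it is contained in the polar $U^\circ=\{\chi\in E':|\chi(x)|\le 1\ \forall x\in U\}$ of some neighborhood $U$ of zero in $E$. $E$ is: $c_0$-barrelled if every $\sigma(E',E)$-null sequence in $E'$ is equicontinuous; $c_0$-quasibarrelled if every $\beta(E',E)$-null sequence in $E'$ is equicontinuous; $\ell_\infty$-quasibarrelled if every $\beta(E',E)$-bounded sequence in $E'$ is equicontinuous. *)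

theory Defs
  imports "HOL-Analysis.Analysis" "HOL-Library.Function_Algebras"
begin

subsection \<open>The vector space of real functions\<close>

instantiation "fun" :: (type, real_vector) real_vector
begin

definition scaleR_fun_def: "c *\<^sub>R f = (\<lambda>x. c *\<^sub>R f x)"

instance
  by standard (simp_all add: scaleR_fun_def fun_eq_iff scaleR_add_right scaleR_add_left)

end

lemma scaleR_fun_apply [simp]: "(c *\<^sub>R f) x = c *\<^sub>R f x"
  by (simp add: scaleR_fun_def)


subsection \<open>Locally convex spaces and their duals\<close>

definition lcs :: "'v::real_vector topology \<Rightarrow> bool" where
  "lcs T \<longleftrightarrow>
     topspace T = UNIV \<and>
     continuous_map (prod_topology T T) T (\<lambda>(x, y). x + y) \<and>
     continuous_map (prod_topology euclideanreal T) T (\<lambda>(c, x). c *\<^sub>R x) \<and>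
     Hausdorff_space T \<and>
     (\<forall>U. openin T U \<and> 0 \<in> U \<longrightarrow> (\<exists>C. openin T C \<and> 0 \<in> C \<and> convex C \<and> C \<subseteq> U))"

definition dual :: "'v::real_vector topology \<Rightarrow> ('v \<Rightarrow> real) set" where
  "dual T = {\<phi>. linear \<phi> \<and> continuous_map T euclideanreal \<phi>}"

text \<open>Von Neumann boundedness. The carrier of \<open>T\<close> may be a proper subspace of the type, so
  that the definition also applies to topologies on the dual.\<close>

definition bounded_in :: "'v::real_vector topology \<Rightarrow> 'v set \<Rightarrow> bool" where
  "bounded_in T B \<longleftrightarrow>
     B \<subseteq> topspace T \<and> (\<forall>U. openin T U \<and> 0 \<in> U \<longrightarrow> (\<exists>r>0. B \<subseteq> (*\<^sub>R) r ` U))"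

definition polar :: "'v::real_vector topology \<Rightarrow> 'v set \<Rightarrow> ('v \<Rightarrow> real) set" where
  "polar T U = {\<phi> \<in> dual T. \<forall>x\<in>U. \<bar>\<phi> x\<bar> \<le> 1}"

definition equicontinuous :: "'v::real_vector topology \<Rightarrow> ('v \<Rightarrow> real) set \<Rightarrow> bool" where
  "equicontinuous T A \<longleftrightarrow> (\<exists>U. openin T U \<and> 0 \<in> U \<and> A \<subseteq> polar T U)"

definition weak_dual :: "'v::real_vector topology \<Rightarrow> ('v \<Rightarrow> real) topology" where
  "weak_dual T = subtopology (powertop_real UNIV) (dual T)"

text \<open>Uniform convergence on bounded sets; by \<open>openin_strong_dual\<close> below, the predicate is a
  topology whenever \<open>T\<close> is locally convex.\<close>

definition strong_dual :: "'v::real_vector topology \<Rightarrow> ('v \<Rightarrow> real) topology" where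
  "strong_dual T = topology (\<lambda>W. W \<subseteq> dual T \<and>
     (\<forall>\<phi>\<in>W. \<exists>B e. bounded_in T B \<and> e > 0 \<and>
        {\<psi> \<in> dual T. \<forall>x\<in>B. \<bar>\<psi> x - \<phi> x\<bar> \<le> e} \<subseteq> W))"

definition c0_barrelled :: "'v::real_vector topology \<Rightarrow> bool" where
  "c0_barrelled T \<longleftrightarrow>
     (\<forall>\<phi> :: nat \<Rightarrow> 'v \<Rightarrow> real. range \<phi> \<subseteq> dual T \<and> limitin (weak_dual T) \<phi> 0 sequentially
        \<longrightarrow> equicontinuous T (range \<phi>))"

definition c0_quasibarrelled :: "'v::real_vector topology \<Rightarrow> bool" where
  "c0_quasibarrelled T \<longleftrightarrow>
     (\<forall>\<phi> :: nat \<Rightarrow> 'v \<Rightarrow> real. range \<phi> \<subseteq> dual T \<and> limitin (strong_dual T) \<phi> 0 sequentially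
        \<longrightarrow> equicontinuous T (range \<phi>))"

definition linf_quasibarrelled :: "'v::real_vector topology \<Rightarrow> bool" where
  "linf_quasibarrelled T \<longleftrightarrow>
     (\<forall>\<phi> :: nat \<Rightarrow> 'v \<Rightarrow> real. range \<phi> \<subseteq> dual T \<and> bounded_in (strong_dual T) (range \<phi>)
        \<longrightarrow> equicontinuous T (range \<phi>))"


subsection \<open>The free locally convex space\<close>

definition lcs_universal ::
    "'e::real_vector itself \<Rightarrow> 'x topology \<Rightarrow> 'v::real_vector topology \<Rightarrow> ('x \<Rightarrow> 'v) \<Rightarrow> bool" where
  "lcs_universal _ X L i \<longleftrightarrow>
     (\<forall>(E :: 'e topology) f. lcs E \<and> continuous_map X E f \<longrightarrow>
        (\<exists>!F. linear F \<and> continuous_map L E F \<and> (\<forall>x\<in>topspace X. F (i x) = f x)))"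

text \<open>A definition cannot quantify over all types, so the targets are the locally convex spaces
  living on the single vector space \<open>'x \<Rightarrow> real\<close>. This loses nothing: by
  \<open>free_lcs_universal\<close> below, the universal property then holds for targets of every type.\<close>

definition free_lcs :: "'x topology \<Rightarrow> 'v::real_vector topology \<Rightarrow> ('x \<Rightarrow> 'v) \<Rightarrow> bool" where
  "free_lcs X L i \<longleftrightarrow>
     lcs L \<and> continuous_map X L i \<and> lcs_universal TYPE('x \<Rightarrow> real) X L i"


subsection \<open>Basic facts\<close>

lemma lcs_topspace: "lcs T \<Longrightarrow> topspace T = UNIV"
  by (simp add: lcs_def)

lemma lcs_continuous_add:
  assumes "lcs T" "continuous_map S T f" "continuous_map S T g"
  shows "continuous_map S T (\<lambda>x. f x + g x)"
proof -
  have "continuous_map S (prod_topology T T) (\<lambda>x. (f x, g x))"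
    using assms by (intro continuous_map_pairedI)
  moreover have "continuous_map (prod_topology T T) T (\<lambda>(x, y). x + y)"
    using assms by (simp add: lcs_def)
  ultimately have "continuous_map S T ((\<lambda>(x, y). x + y) \<circ> (\<lambda>x. (f x, g x)))"
    by (rule continuous_map_compose)
  then show ?thesis by (simp add: o_def)
qed

lemma lcs_continuous_scaleR:
  assumes "lcs T" "continuous_map S euclideanreal c" "continuous_map S T g"
  shows "continuous_map S T (\<lambda>x. c x *\<^sub>R g x)"
proof -
  have "continuous_map S (prod_topology euclideanreal T) (\<lambda>x. (c x, g x))"
    using assms by (intro continuous_map_pairedI)
  moreover have "continuous_map (prod_topology euclideanreal T) T (\<lambda>(c, x). c *\<^sub>R x)"
    using assms by (simp add: lcs_def)
  ultimately have "continuous_map S T ((\<lambda>(c, x). c *\<^sub>R x) \<circ> (\<lambda>x. (c x, g x)))"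
    by (rule continuous_map_compose)
  then show ?thesis by (simp add: o_def)
qed

lemma lcs_openin_affine:
  assumes "lcs T" "openin T U"
  shows "openin T {y. c *\<^sub>R (y + a) \<in> U}"
proof -
  have "continuous_map T T (\<lambda>y. c *\<^sub>R (y + a))"
    using assms(1) by (intro lcs_continuous_scaleR lcs_continuous_add) (auto simp: lcs_topspace)
  from openin_continuous_map_preimage[OF this assms(2)] show ?thesis
    using assms(1) by (simp add: lcs_topspace)
qed

lemma lcs_convexE:
  assumes "lcs T" "openin T U" "0 \<in> U"
  obtains C where "openin T C" "0 \<in> C" "convex C" "C \<subseteq> U"
  using assms unfolding lcs_def by blast

lemma bounded_in_Un:
  assumes T: "lcs T" and A: "bounded_in T A" and B: "bounded_in T B"
  shows "bounded_in T (A \<union> B)"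
  unfolding bounded_in_def
proof (intro conjI allI impI)
  show "A \<union> B \<subseteq> topspace T" using A B by (auto simp: bounded_in_def)
  fix U assume "openin T U \<and> 0 \<in> U"
  then obtain C where C: "openin T C" "0 \<in> C" "convex C" "C \<subseteq> U"
    using T lcs_convexE by metis
  obtain r where r: "r > 0" "A \<subseteq> (*\<^sub>R) r ` C" using A C by (auto simp: bounded_in_def)
  obtain s where s: "s > 0" "B \<subseteq> (*\<^sub>R) s ` C" using B C by (auto simp: bounded_in_def)
  have *: "(*\<^sub>R) a ` C \<subseteq> (*\<^sub>R) b ` C" if "0 < a" "a \<le> b" for a b :: real
  proof
    fix z assume "z \<in> (*\<^sub>R) a ` C"
    then obtain y where y: "y \<in> C" "z = a *\<^sub>R y" by auto
    have "(a / b) *\<^sub>R y + (1 - a / b) *\<^sub>R 0 \<in> C"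
      using that by (intro convexD[OF C(3) y(1) C(2)]) (auto simp: field_simps)
    then have "(a / b) *\<^sub>R y \<in> C" by simp
    moreover have "z = b *\<^sub>R ((a / b) *\<^sub>R y)" using that y by simp
    ultimately show "z \<in> (*\<^sub>R) b ` C" by blast
  qed
  have "A \<union> B \<subseteq> (*\<^sub>R) (max r s) ` C"
    using r s *[of r "max r s"] *[of s "max r s"] by auto
  also have "\<dots> \<subseteq> (*\<^sub>R) (max r s) ` U" using C(4) by auto
  finally show "\<exists>t>0. A \<union> B \<subseteq> (*\<^sub>R) t ` U" using r(1) by (meson less_max_iff_disj)
qed

lemma openin_strong_dual:
  assumes "lcs T"
  shows "openin (strong_dual T) W \<longleftrightarrow> W \<subseteq> dual T \<and>
     (\<forall>\<phi>\<in>W. \<exists>B e. bounded_in T B \<and> e > 0 \<and>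
        {\<psi> \<in> dual T. \<forall>x\<in>B. \<bar>\<psi> x - \<phi> x\<bar> \<le> e} \<subseteq> W)"
    (is "_ \<longleftrightarrow> ?P W")
proof -
  have "istopology ?P"
    unfolding istopology_def
  proof (rule conjI; intro allI impI)
    fix S U assume S: "?P S" and U: "?P U"
    have "\<exists>B e. bounded_in T B \<and> e > 0 \<and> {\<psi> \<in> dual T. \<forall>x\<in>B. \<bar>\<psi> x - \<phi> x\<bar> \<le> e} \<subseteq> S \<inter> U"
      if mem: "\<phi> \<in> S \<inter> U" for \<phi>
    proof -
      obtain B e where 1: "bounded_in T B" "e > 0"
        "{\<psi> \<in> dual T. \<forall>x\<in>B. \<bar>\<psi> x - \<phi> x\<bar> \<le> e} \<subseteq> S" using S mem by blast
      obtain B' e' where 2: "bounded_in T B'" "e' > 0"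
        "{\<psi> \<in> dual T. \<forall>x\<in>B'. \<bar>\<psi> x - \<phi> x\<bar> \<le> e'} \<subseteq> U" using U mem by blast
      have "{\<psi> \<in> dual T. \<forall>x\<in>B \<union> B'. \<bar>\<psi> x - \<phi> x\<bar> \<le> min e e'} \<subseteq> S \<inter> U"
        using 1(3) 2(3) by auto
      then show ?thesis
        using bounded_in_Un[OF assms 1(1) 2(1)] 1(2) 2(2) by (meson min_less_iff_conj)
    qed
    then show "?P (S \<inter> U)" using S by blast
  next
    fix K assume "\<forall>S\<in>K. ?P S"
    then have P: "\<And>S. S \<in> K \<Longrightarrow> ?P S" by blast
    have "\<exists>B e. bounded_in T B \<and> e > 0 \<and> {\<psi> \<in> dual T. \<forall>x\<in>B. \<bar>\<psi> x - \<phi> x\<bar> \<le> e} \<subseteq> \<Union>K"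
      if "\<phi> \<in> \<Union>K" for \<phi>
    proof -
      from that obtain S where S: "S \<in> K" "\<phi> \<in> S" by blast
      obtain B e where "bounded_in T B" "e > 0"
        "{\<psi> \<in> dual T. \<forall>x\<in>B. \<bar>\<psi> x - \<phi> x\<bar> \<le> e} \<subseteq> S"
        using P[OF S(1)] S(2) by blast
      then show ?thesis using S(1) by (meson Union_upper subset_trans)
    qed
    moreover have "\<Union>K \<subseteq> dual T" using P by blast
    ultimately show "?P (\<Union>K)" by blast
  qed
  then show ?thesis
    unfolding strong_dual_def by (simp add: topology_inverse')
qed


subsection \<open>Continuous functionals separate points\<close>

definition sublin :: "('v::real_vector \<Rightarrow> real) \<Rightarrow> bool" where
  "sublin p \<longleftrightarrow> p 0 = 0 \<and> (\<forall>x y. p (x + y) \<le> p x + p y) \<and> (\<forall>t>0. \<forall>x. p (t *\<^sub>R x) \<le> t * p x)"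

lemma sublin_scale:
  assumes "sublin p" "t \<ge> 0"
  shows "p (t *\<^sub>R x) = t * p x"
proof (cases "t = 0")
  case True then show ?thesis using assms by (simp add: sublin_def)
next
  case False
  then have t: "t > 0" using assms by simp
  have "p ((1 / t) *\<^sub>R (t *\<^sub>R x)) \<le> (1 / t) * p (t *\<^sub>R x)"
    using assms(1) t unfolding sublin_def by (meson divide_pos_pos zero_less_one)
  then have "t * p x \<le> p (t *\<^sub>R x)" using t by (simp add: field_simps)
  moreover have "p (t *\<^sub>R x) \<le> t * p x" using assms(1) t unfolding sublin_def by blast
  ultimately show ?thesis by simp
qed

lemma sublin_neg: "sublin p \<Longrightarrow> - p (- x) \<le> p x"
  unfolding sublin_def by (metis add.right_inverse add.commute minus_le_iff le_add_same_cancel1 add_le_cancel_left diff_ge_0_iff_ge diff_minus_eq_add neg_le_iff_le)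

lemma sublin_shift:
  fixes u :: "'v::real_vector"
  assumes p: "sublin p"
  shows "\<exists>q. sublin q \<and> (\<forall>x. q x \<le> p x) \<and> q (- u) \<le> - p u"
proof -
  define g where "g x t = p (x + t *\<^sub>R u) - t * p u" for x and t :: real
  define q where "q x = (INF t\<in>{0..}. g x t)" for x
  have sub: "p (x + y) \<le> p x + p y" for x y using p by (simp add: sublin_def)
  have low: "- p (- x) \<le> g x t" if "t \<ge> 0" for x t
  proof -
    have "t * p u = p ((x + t *\<^sub>R u) + (- x))" using sublin_scale[OF p that] by simp
    also have "\<dots> \<le> p (x + t *\<^sub>R u) + p (- x)" by (rule sub)
    finally show ?thesis by (simp add: g_def)
  qed
  have bdd: "bdd_below (g x ` {0..})" for x
    using low by (intro bdd_belowI2[of _ "- p (- x)"]) auto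
  have le: "q x \<le> g x t" if "t \<ge> 0" for x t
    unfolding q_def using that bdd by (intro cINF_lower) auto
  have ge: "c \<le> q x" if "\<And>t. t \<ge> 0 \<Longrightarrow> c \<le> g x t" for c x
    unfolding q_def using that by (intro cINF_greatest) auto
  have "q 0 = 0"
  proof (rule antisym)
    show "q 0 \<le> 0" using le[of 0 0] p by (simp add: g_def sublin_def)
    show "0 \<le> q 0" using p sublin_scale[OF p] by (intro ge) (simp add: g_def)
  qed
  moreover have "q (x + y) \<le> q x + q y" for x y
  proof -
    have 1: "q (x + y) \<le> g x s + g y t" if "s \<ge> 0" "t \<ge> 0" for s t
    proof -
      have "q (x + y) \<le> g (x + y) (s + t)" using that by (intro le) simp
      also have "p ((x + y) + (s + t) *\<^sub>R u) = p ((x + s *\<^sub>R u) + (y + t *\<^sub>R u))"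
        by (simp add: algebra_simps)
      then have "g (x + y) (s + t) \<le> g x s + g y t"
        using sub[of "x + s *\<^sub>R u" "y + t *\<^sub>R u"] by (simp add: g_def algebra_simps)
      finally show ?thesis .
    qed
    have 2: "q (x + y) - g x s \<le> q y" if "s \<ge> 0" for s
      using 1[OF that] by (intro ge) (simp add: algebra_simps)
    have "q (x + y) - q y \<le> q x"
      using 2 by (intro ge) (simp add: algebra_simps)
    then show ?thesis by simp
  qed
  moreover have "q (c *\<^sub>R x) \<le> c * q x" if "c > 0" for c x
  proof -
    have "q (c *\<^sub>R x) / c \<le> g x t" if "t \<ge> 0" for t
    proof -
      have "q (c *\<^sub>R x) \<le> g (c *\<^sub>R x) (c * t)" using that \<open>c > 0\<close> by (intro le) simp
      also have "\<dots> = c * g x t"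
        using sublin_scale[OF p, of c "x + t *\<^sub>R u"] \<open>c > 0\<close> by (simp add: g_def algebra_simps)
      finally show ?thesis using \<open>c > 0\<close> by (simp add: field_simps)
    qed
    then have "q (c *\<^sub>R x) / c \<le> q x" by (rule ge)
    then show ?thesis using that by (simp add: field_simps)
  qed
  ultimately have "sublin q" by (simp add: sublin_def)
  moreover have "q x \<le> p x" for x using le[of 0 x] by (simp add: g_def)
  moreover have "q (- u) \<le> - p u" using le[of 1 "- u"] p by (simp add: g_def sublin_def)
  ultimately show ?thesis by blast
qed

lemma sublin_minimal:
  fixes p :: "'v::real_vector \<Rightarrow> real"
  assumes p: "sublin p"
  shows "\<exists>q. sublin q \<and> (\<forall>x. q x \<le> p x) \<and> (\<forall>r. sublin r \<and> (\<forall>x. r x \<le> q x) \<longrightarrow> r = q)"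
proof -
  define A where "A = {q. sublin q \<and> (\<forall>x. q x \<le> p x)}"
  define P where "P q r \<longleftrightarrow> (\<forall>x. r x \<le> q x)" for q r :: "'v \<Rightarrow> real"
  have "\<exists>m\<in>A. \<forall>a\<in>A. P m a \<longrightarrow> a = m"
  proof (rule predicate_Zorn)
    show "partial_order_on A (relation_of P A)"
      by (rule partial_order_on_relation_ofI) (auto simp: P_def fun_eq_iff intro: order_trans antisym)
    fix C assume C: "C \<in> Chains (relation_of P A)"
    then have CA: "C \<subseteq> A" unfolding Chains_def relation_of_def by auto
    have tot: "P a b \<or> P b a" if "a \<in> C" "b \<in> C" for a b
      using C that unfolding Chains_def relation_of_def by auto
    show "\<exists>u\<in>A. \<forall>a\<in>C. P a u"
    proof (cases "C = {}")
      case True then show ?thesis using p by (auto simp: A_def)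
    next
      case False
      have sl: "sublin c" "c x \<le> p x" if "c \<in> C" for c x using that CA by (auto simp: A_def)
      define q where "q x = (INF c\<in>C. c x)" for x
      have low: "- p (- x) \<le> c x" if "c \<in> C" for c x
        using sublin_neg[OF sl(1)[OF that], of x] sl(2)[OF that, of "- x"] by linarith
      have le: "q x \<le> c x" if "c \<in> C" for c x
        unfolding q_def using that low by (intro cINF_lower bdd_belowI2[of _ "- p (- x)"]) auto
      have ge: "b \<le> q x" if "\<And>c. c \<in> C \<Longrightarrow> b \<le> c x" for b x
        unfolding q_def using that False by (intro cINF_greatest) auto
      have "q 0 = 0"
      proof -
        have "c 0 = 0" if "c \<in> C" for c using sl(1)[OF that] by (simp add: sublin_def)
        then have "(\<lambda>c. c 0) ` C = {0}" using False by force
        then show ?thesis by (simp add: q_def)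
      qed
      moreover have "q (x + y) \<le> q x + q y" for x y
      proof -
        have 1: "q (x + y) \<le> a x + b y" if ab: "a \<in> C" "b \<in> C" for a b
        proof -
          have "(\<forall>x. b x \<le> a x) \<or> (\<forall>x. a x \<le> b x)"
            using tot ab unfolding P_def by blast
          then obtain c where c: "c \<in> C" "c x \<le> a x" "c y \<le> b y"
            using ab by (meson order_refl)
          have "q (x + y) \<le> c (x + y)" using c by (intro le)
          also have "\<dots> \<le> c x + c y" using sl(1)[OF c(1)] by (simp add: sublin_def)
          finally show ?thesis using c by linarith
        qed
        have 2: "q (x + y) - a x \<le> q y" if "a \<in> C" for a
          using 1[OF that] by (intro ge) (simp add: algebra_simps)
        have "q (x + y) - q y \<le> q x" using 2 by (intro ge) (simp add: algebra_simps)
        then show ?thesis by simp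
      qed
      moreover have "q (t *\<^sub>R x) \<le> t * q x" if "t > 0" for t x
      proof -
        have "q (t *\<^sub>R x) / t \<le> c x" if "c \<in> C" for c
        proof -
          have "q (t *\<^sub>R x) \<le> c (t *\<^sub>R x)" using that by (rule le)
          also have "\<dots> = t * c x" using sublin_scale[OF sl(1)[OF that]] \<open>t > 0\<close> by simp
          finally show ?thesis using \<open>t > 0\<close> by (simp add: field_simps)
        qed
        then have "q (t *\<^sub>R x) / t \<le> q x" by (rule ge)
        then show ?thesis using that by (simp add: field_simps)
      qed
      ultimately have "sublin q" by (simp add: sublin_def)
      moreover have "q x \<le> p x" for x using False le sl(2) by (meson ex_in_conv order_trans)
      ultimately show ?thesis using le by (auto simp: A_def P_def)
    qed
  qed
  then obtain m where m: "m \<in> A" "\<And>a. a \<in> A \<Longrightarrow> P m a \<Longrightarrow> a = m" by blast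
  have "r = m" if "sublin r" "\<forall>x. r x \<le> m x" for r
    using m that by (auto simp: A_def P_def intro: order_trans)
  then show ?thesis using m(1) by (auto simp: A_def)
qed

lemma Hahn_Banach_sublin:
  fixes p :: "'v::real_vector \<Rightarrow> real"
  assumes "sublin p"
  shows "\<exists>\<phi>. linear \<phi> \<and> (\<forall>x. \<phi> x \<le> p x) \<and> p u \<le> \<phi> u"
proof -
  obtain q where q: "sublin q" "\<And>x. q x \<le> p x" "q (- u) \<le> - p u"
    using sublin_shift[OF assms] by blast
  obtain m where m: "sublin m" "\<And>x. m x \<le> q x" "\<And>r. sublin r \<Longrightarrow> (\<And>x. r x \<le> m x) \<Longrightarrow> r = m"
    using sublin_minimal[OF q(1)] by blast
  have neg: "m (- x) = - m x" for x
  proof (rule antisym)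
    obtain r where "sublin r" "\<And>y. r y \<le> m y" "r (- x) \<le> - m x"
      using sublin_shift[OF m(1)] by blast
    then show "m (- x) \<le> - m x" using m(3) by metis
    show "- m x \<le> m (- x)" using sublin_neg[OF m(1), of "- x"] by simp
  qed
  have sub: "m (x + y) \<le> m x + m y" for x y using m(1) by (simp add: sublin_def)
  have "linear m"
  proof (rule linearI)
    fix x y
    have "- m (x + y) \<le> - m x + - m y"
      using sub[of "- x" "- y"] neg by (metis minus_add_distrib)
    then show "m (x + y) = m x + m y" using sub[of x y] by linarith
  next
    fix c x
    show "m (c *\<^sub>R x) = c *\<^sub>R m x"
    proof (cases "c \<ge> 0")
      case True then show ?thesis using sublin_scale[OF m(1)] by simp
    next
      case False
      then have "m ((- c) *\<^sub>R x) = (- c) * m x" by (intro sublin_scale[OF m(1)]) simp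
      then have "m (- (c *\<^sub>R x)) = - (c * m x)" by simp
      then show ?thesis using neg[of "c *\<^sub>R x"] by simp
    qed
  qed
  moreover have "m x \<le> p x" for x using m(2) q(2) order_trans by blast
  moreover have "p u \<le> m u" using m(2)[of "- u"] q(3) neg[of u] by linarith
  ultimately show ?thesis by blast
qed

lemma linear_continuous_nbhd:
  assumes T: "lcs T" and \<phi>: "linear \<phi>" and D: "openin T D" "0 \<in> D" "\<And>x. x \<in> D \<Longrightarrow> \<bar>\<phi> x\<bar> \<le> 1"
  shows "continuous_map T euclideanreal \<phi>"
  unfolding continuous_map_def
proof (intro conjI allI impI)
  have scale: "\<phi> (c *\<^sub>R (y + - x)) = c * (\<phi> y - \<phi> x)" for c x y
    by (simp add: linear_cmul[OF \<phi>] linear_diff[OF \<phi>])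
  fix W :: "real set" assume "openin euclideanreal W"
  then have W: "open W" by simp
  show "openin T {x \<in> topspace T. \<phi> x \<in> W}"
  proof (subst openin_subopen, intro ballI)
    fix x assume "x \<in> {x \<in> topspace T. \<phi> x \<in> W}"
    then have "\<phi> x \<in> W" by simp
    then obtain e where e: "e > 0" "ball (\<phi> x) e \<subseteq> W" using W open_contains_ball by blast
    let ?N = "{y. (2 / e) *\<^sub>R (y + (- x)) \<in> D}"
    have "\<phi> y \<in> W" if "y \<in> ?N" for y
    proof -
      have "\<bar>\<phi> ((2 / e) *\<^sub>R (y + (- x)))\<bar> \<le> 1" using that by (intro D(3)) simp
      also have "\<phi> ((2 / e) *\<^sub>R (y + (- x))) = (2 / e) * (\<phi> y - \<phi> x)"
        by (rule scale)
      also have "\<bar>(2 / e) * (\<phi> y - \<phi> x)\<bar> = 2 * \<bar>\<phi> y - \<phi> x\<bar> / e"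
        using e(1) by (simp only: abs_mult) simp
      finally have "2 * \<bar>\<phi> y - \<phi> x\<bar> \<le> e" using e(1) by (simp add: divide_le_eq)
      then have "\<bar>\<phi> x - \<phi> y\<bar> < e" using e(1) abs_minus_commute[of "\<phi> x" "\<phi> y"] by argo
      then have "\<phi> y \<in> ball (\<phi> x) e" by (simp add: dist_real_def)
      then show ?thesis using e(2) by blast
    qed
    moreover have "openin T ?N" using lcs_openin_affine[OF T D(1)] .
    moreover have "x \<in> ?N" using D(2) by simp
    ultimately show "\<exists>N. openin T N \<and> x \<in> N \<and> N \<subseteq> {x \<in> topspace T. \<phi> x \<in> W}"
      using lcs_topspace[OF T] by (intro exI[of _ ?N]) auto
  qed
qed auto

lemma lcs_dual_separates:
  assumes T: "lcs T" and u: "u \<noteq> 0"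
  shows "\<exists>\<phi>\<in>dual T. \<phi> u \<noteq> 0"
proof -
  obtain U where "openin T U" "0 \<in> U" "u \<notin> U"
    using T u unfolding lcs_def Hausdorff_space_def disjnt_def by (metis UNIV_I disjoint_iff)
  then obtain C where C: "openin T C" "0 \<in> C" "convex C" "u \<notin> C"
    using lcs_convexE[OF T] by (metis subsetD)
  define M where "M x = {t. t > 0 \<and> (1 / t) *\<^sub>R x \<in> C}" for x
  define p where "p x = Inf (M x)" for x
  have ne: "M x \<noteq> {}" for x
  proof -
    have "continuous_map euclideanreal T (\<lambda>c. c *\<^sub>R x)"
      using T by (intro lcs_continuous_scaleR) (auto simp: lcs_topspace)
    from openin_continuous_map_preimage[OF this C(1)]
    have "open {c. c *\<^sub>R x \<in> C}" by simp
    moreover have "0 \<in> {c. c *\<^sub>R x \<in> C}" using C by simp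
    ultimately obtain e where e: "e > 0" "ball 0 e \<subseteq> {c. c *\<^sub>R x \<in> C}"
      using open_contains_ball by blast
    moreover have "e / 2 \<in> ball 0 e" using e(1) by (simp add: dist_real_def)
    ultimately have "(e / 2) \<in> {c. c *\<^sub>R x \<in> C}" using e(2) by blast
    then have "2 / e \<in> M x" using e(1) by (simp add: M_def)
    then show ?thesis by blast
  qed
  have bdd: "bdd_below (M x)" for x by (rule bdd_belowI[of _ 0]) (auto simp: M_def)
  have le: "p x \<le> t" if "t \<in> M x" for x t unfolding p_def using that bdd by (rule cInf_lower)
  have ge: "b \<le> p x" if "\<And>t. t \<in> M x \<Longrightarrow> b \<le> t" for b x
    unfolding p_def using that ne by (intro cInf_greatest) auto
  have "p 0 = 0"
  proof (rule antisym)
    have "p 0 \<le> 0 + e" if "e > 0" for e using le[of e 0] C(2) that by (simp add: M_def)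
    then show "p 0 \<le> 0" by (rule field_le_epsilon)
    show "0 \<le> p 0" by (rule ge) (simp add: M_def)
  qed
  moreover have "p (x + y) \<le> p x + p y" for x y
  proof -
    have 1: "p (x + y) \<le> s + t" if "s \<in> M x" "t \<in> M y" for s t
    proof (rule le)
      have st: "s > 0" "t > 0" "(1 / s) *\<^sub>R x \<in> C" "(1 / t) *\<^sub>R y \<in> C"
        using that by (auto simp: M_def)
      have "(s / (s + t)) *\<^sub>R ((1 / s) *\<^sub>R x) + (t / (s + t)) *\<^sub>R ((1 / t) *\<^sub>R y) \<in> C"
        using st by (intro convexD[OF C(3)]) (auto simp: add_divide_distrib[symmetric])
      then have "(1 / (s + t)) *\<^sub>R (x + y) \<in> C" using st by (simp add: scaleR_add_right)
      then show "s + t \<in> M (x + y)" using st by (simp add: M_def)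
    qed
    have 2: "p (x + y) - s \<le> p y" if "s \<in> M x" for s
      using 1[OF that] by (intro ge) (simp add: algebra_simps)
    have "p (x + y) - p y \<le> p x" using 2 by (intro ge) (simp add: algebra_simps)
    then show ?thesis by simp
  qed
  moreover have "p (c *\<^sub>R x) \<le> c * p x" if "c > 0" for c x
  proof -
    have "p (c *\<^sub>R x) / c \<le> t" if "t \<in> M x" for t
    proof -
      have "c * t \<in> M (c *\<^sub>R x)" using that \<open>c > 0\<close> by (simp add: M_def)
      then show ?thesis using le \<open>c > 0\<close> by (simp add: field_simps)
    qed
    then have "p (c *\<^sub>R x) / c \<le> p x" by (rule ge)
    then show ?thesis using that by (simp add: field_simps)
  qed
  ultimately have "sublin p" by (simp add: sublin_def)
  then obtain \<phi> where \<phi>: "linear \<phi>" "\<And>x. \<phi> x \<le> p x" "p u \<le> \<phi> u"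
    using Hahn_Banach_sublin by blast
  have "1 \<le> p u"
  proof (rule ge, rule ccontr)
    fix t assume t: "t \<in> M u" "\<not> 1 \<le> t"
    then have "t *\<^sub>R ((1 / t) *\<^sub>R u) + (1 - t) *\<^sub>R 0 \<in> C"
      by (intro convexD[OF C(3)] C(2)) (auto simp: M_def)
    then show False using t C(4) by (simp add: M_def)
  qed
  then have "\<phi> u \<noteq> 0" using \<phi>(3) by linarith
  moreover have "continuous_map T euclideanreal \<phi>"
  proof (rule linear_continuous_nbhd[OF T \<phi>(1)])
    show "openin T (C \<inter> {y. (- 1) *\<^sub>R (y + 0) \<in> C})"
      using lcs_openin_affine[OF T C(1)] C(1) by (rule openin_Int[rotated])
    show "0 \<in> C \<inter> {y. (- 1) *\<^sub>R (y + 0) \<in> C}" using C(2) by simp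
    fix x assume x: "x \<in> C \<inter> {y. (- 1) *\<^sub>R (y + 0) \<in> C}"
    have "\<phi> y \<le> 1" if "y \<in> C" for y
      using \<phi>(2)[of y] le[of 1 y] that by (simp add: M_def)
    from this[of x] this[of "- x"] x show "\<bar>\<phi> x\<bar> \<le> 1"
      using \<phi>(1) by (simp add: linear_neg)
  qed
  ultimately show ?thesis using \<phi>(1) by (auto simp: dual_def)
qed


subsection \<open>Constructions of locally convex spaces\<close>

lemma lcs_powertop_real: "lcs (powertop_real (UNIV :: 'x set))"
proof -
  have *: "continuous_map (powertop_real (UNIV :: 'x set)) euclideanreal (\<lambda>f. f i)" for i
    by (rule continuous_map_product_projection) simp
  have fst: "continuous_map (prod_topology S T) euclideanreal (\<lambda>z. fst z i)"
    if "S = powertop_real (UNIV :: 'x set)" for S and T :: "'b topology" and i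
    using continuous_map_compose[OF continuous_map_fst *[of i], of T] that by (simp add: o_def)
  have snd: "continuous_map (prod_topology S T) euclideanreal (\<lambda>z. snd z i)"
    if "T = powertop_real (UNIV :: 'x set)" for T and S :: "'b topology" and i
    using continuous_map_compose[OF continuous_map_snd *[of i], of S] that by (simp add: o_def)
  have "\<exists>C. openin (powertop_real UNIV) C \<and> 0 \<in> C \<and> convex C \<and> C \<subseteq> U"
    if U: "openin (powertop_real UNIV) U" "0 \<in> U" for U :: "('x \<Rightarrow> real) set"
  proof -
    obtain V where V: "0 \<in> (\<Pi>\<^sub>E i\<in>UNIV. V i)" "\<And>i. open (V i)" "finite {i. V i \<noteq> UNIV}"
      "(\<Pi>\<^sub>E i\<in>UNIV. V i) \<subseteq> U"
      using product_topology_open_contains_basis[OF U] by auto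
    have "\<exists>e>0. ball 0 e \<subseteq> V i" for i
      using V(1,2) open_contains_ball[of "V i"] by (auto simp: PiE_iff)
    then obtain e where e: "\<And>i. e i > 0" "\<And>i. ball 0 (e i) \<subseteq> V i" by metis
    define C where "C = (\<Pi>\<^sub>E i\<in>(UNIV :: 'x set). if V i = UNIV then UNIV else ball (0::real) (e i))"
    have "finite {i. (if V i = UNIV then UNIV else ball 0 (e i)) \<noteq> (UNIV :: real set)}"
      by (rule finite_subset[OF _ V(3)]) auto
    then have "openin (powertop_real UNIV) C"
      unfolding C_def by (subst openin_PiE_gen) auto
    moreover have "0 \<in> C" using e(1) by (auto simp: C_def)
    moreover have "convex C"
    proof -
      have "C = (\<Inter>i\<in>{i. V i \<noteq> UNIV}. {f. f i \<in> ball 0 (e i)})"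
      proof (intro set_eqI)
        fix f :: "'x \<Rightarrow> real"
        have "f \<in> C \<longleftrightarrow> (\<forall>i. V i = UNIV \<or> f i \<in> ball 0 (e i))"
          unfolding C_def by (simp add: PiE_iff) metis
        also have "\<dots> \<longleftrightarrow> f \<in> (\<Inter>i\<in>{i. V i \<noteq> UNIV}. {f. f i \<in> ball 0 (e i)})" by blast
        finally show "f \<in> C \<longleftrightarrow> f \<in> (\<Inter>i\<in>{i. V i \<noteq> UNIV}. {f. f i \<in> ball 0 (e i)})" .
      qed
      moreover have "convex {f. f i \<in> ball (0::real) (e i)}" for i :: 'x
      proof (rule convexI)
        fix f g :: "'x \<Rightarrow> real" and u v :: real
        assume "f \<in> {f. f i \<in> ball 0 (e i)}" "g \<in> {f. f i \<in> ball 0 (e i)}" "0 \<le> u" "0 \<le> v" "u + v = 1"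
        then have "u *\<^sub>R f i + v *\<^sub>R g i \<in> ball 0 (e i)"
          by (intro convexD[OF convex_ball]) simp_all
        then show "u *\<^sub>R f + v *\<^sub>R g \<in> {f. f i \<in> ball 0 (e i)}" by simp
      qed
      ultimately show ?thesis by (auto intro: convex_INT)
    qed
    moreover have "C \<subseteq> U"
    proof -
      have "C \<subseteq> (\<Pi>\<^sub>E i\<in>UNIV. V i)" unfolding C_def using e(2) by (intro PiE_mono) auto
      then show ?thesis using V(4) by blast
    qed
    ultimately show ?thesis by blast
  qed
  moreover have "continuous_map (prod_topology (powertop_real (UNIV :: 'x set)) (powertop_real UNIV))
      (powertop_real UNIV) (\<lambda>(x, y). x + y)"
    by (auto simp: continuous_map_componentwise_UNIV case_prod_unfold intro!: continuous_map_add fst snd)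
  moreover have "continuous_map (prod_topology euclideanreal (powertop_real (UNIV :: 'x set)))
      (powertop_real UNIV) (\<lambda>(c, x). c *\<^sub>R x)"
    by (auto simp: continuous_map_componentwise_UNIV case_prod_unfold
        intro!: continuous_map_real_mult continuous_map_fst snd)
  moreover have "Hausdorff_space (powertop_real (UNIV :: 'x set))"
    by (simp add: Hausdorff_space_product_topology)
  ultimately show ?thesis by (simp add: lcs_def)
qed

lemma lcs_prod:
  fixes S :: "'a::real_vector topology" and T :: "'b::real_vector topology"
  assumes S: "lcs S" and T: "lcs T"
  shows "lcs (prod_topology S T)"
proof -
  let ?P = "prod_topology S T"
  have fst: "continuous_map R S (\<lambda>z. fst (h z))" if "continuous_map R ?P h" for R and h :: "'c \<Rightarrow> _"
    using continuous_map_compose[OF that continuous_map_fst] by (simp add: o_def)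
  have snd: "continuous_map R T (\<lambda>z. snd (h z))" if "continuous_map R ?P h" for R and h :: "'c \<Rightarrow> _"
    using continuous_map_compose[OF that continuous_map_snd] by (simp add: o_def)
  have "continuous_map (prod_topology ?P ?P) ?P (\<lambda>z. (fst (fst z) + fst (snd z), snd (fst z) + snd (snd z)))"
    by (intro continuous_map_pairedI lcs_continuous_add[OF S] lcs_continuous_add[OF T]
        fst snd continuous_map_fst continuous_map_snd)
  then have "continuous_map (prod_topology ?P ?P) ?P (\<lambda>(x, y). x + y)"
    by (simp add: case_prod_unfold plus_prod_def)
  moreover have "continuous_map (prod_topology euclideanreal ?P) ?P
      (\<lambda>z. (fst z *\<^sub>R fst (snd z), fst z *\<^sub>R snd (snd z)))"
    by (intro continuous_map_pairedI lcs_continuous_scaleR[OF S] lcs_continuous_scaleR[OF T]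
        fst snd continuous_map_fst continuous_map_snd)
  then have "continuous_map (prod_topology euclideanreal ?P) ?P (\<lambda>(c, x). c *\<^sub>R x)"
    by (simp add: case_prod_unfold scaleR_prod_def)
  moreover have "Hausdorff_space ?P"
    using S T by (simp add: lcs_def Hausdorff_space_prod_topology)
  moreover have "\<exists>C. openin ?P C \<and> 0 \<in> C \<and> convex C \<and> C \<subseteq> U"
    if U: "openin ?P U" "0 \<in> U" for U
  proof -
    have 0: "(0, 0) \<in> U" using U(2) by (simp add: zero_prod_def)
    obtain V W where VW: "openin S V" "openin T W" "0 \<in> V" "0 \<in> W" "V \<times> W \<subseteq> U"
      using U(1)[unfolded openin_prod_topology_alt, rule_format, OF 0] by (elim exE conjE)
    obtain C where C: "openin S C" "0 \<in> C" "convex C" "C \<subseteq> V" using lcs_convexE[OF S VW(1,3)] .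
    obtain D where D: "openin T D" "0 \<in> D" "convex D" "D \<subseteq> W" using lcs_convexE[OF T VW(2,4)] .
    from C D show ?thesis using VW(5)
      by (intro exI[of _ "C \<times> D"]) (auto simp: openin_prod_Times_iff convex_Times zero_prod_def)
  qed
  ultimately show ?thesis using S T by (simp add: lcs_def)
qed

lemma lcs_pullback:
  fixes k :: "'a::real_vector \<Rightarrow> 'b::real_vector"
  assumes T: "lcs T" and k: "linear k" "inj k"
  shows "lcs (pullback_topology UNIV k T)"
proof -
  let ?P = "pullback_topology UNIV k T"
  have top: "topspace ?P = UNIV" by (simp add: topspace_pullback_topology lcs_topspace[OF T])
  have k': "continuous_map R T (\<lambda>z. k (h z))" if "continuous_map R ?P h" for R and h :: "'c \<Rightarrow> _"
    using continuous_map_compose[OF that continuous_map_pullback[OF continuous_map_id]]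
    by (simp add: o_def)
  have into: "continuous_map R ?P h" if "continuous_map R T (\<lambda>z. k (h z))" for R and h :: "'c \<Rightarrow> _"
    using that by (intro continuous_map_pullback') (simp_all add: o_def)
  have "continuous_map (prod_topology ?P ?P) T (\<lambda>z. k (fst z) + k (snd z))"
    by (intro lcs_continuous_add[OF T] k' continuous_map_fst continuous_map_snd)
  then have "continuous_map (prod_topology ?P ?P) ?P (\<lambda>(x, y). x + y)"
    by (intro into) (simp add: case_prod_unfold linear_add[OF k(1)])
  moreover have "continuous_map (prod_topology euclideanreal ?P) T (\<lambda>z. fst z *\<^sub>R k (snd z))"
    by (intro lcs_continuous_scaleR[OF T] k' continuous_map_fst continuous_map_snd)
  then have "continuous_map (prod_topology euclideanreal ?P) ?P (\<lambda>(c, x). c *\<^sub>R x)"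
    by (intro into) (simp add: case_prod_unfold linear_cmul[OF k(1)])
  moreover have "Hausdorff_space ?P"
    unfolding Hausdorff_space_def
  proof (intro allI impI, elim conjE)
    fix x y :: 'a assume "x \<noteq> y"
    then have "k x \<noteq> k y" using k(2) by (simp add: inj_eq)
    then obtain U V where "openin T U" "openin T V" "k x \<in> U" "k y \<in> V" "disjnt U V"
      using T unfolding lcs_def Hausdorff_space_def by blast
    then show "\<exists>U V. openin ?P U \<and> openin ?P V \<and> x \<in> U \<and> y \<in> V \<and> disjnt U V"
      by (intro exI[of _ "k -` U"] exI[of _ "k -` V"])
        (auto simp: openin_pullback_topology disjnt_def)
  qed
  moreover have "\<exists>C. openin ?P C \<and> 0 \<in> C \<and> convex C \<and> C \<subseteq> U" if U: "openin ?P U" "0 \<in> U" for U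
  proof -
    obtain V where V: "openin T V" "U = k -` V" using U by (auto simp: openin_pullback_topology)
    then have "0 \<in> V" using U(2) k(1) by (simp add: linear_0)
    then obtain C where C: "openin T C" "0 \<in> C" "convex C" "C \<subseteq> V"
      using lcs_convexE[OF T V(1)] by metis
    then show ?thesis using V(2) k(1)
      by (intro exI[of _ "k -` C"])
        (auto simp: openin_pullback_topology linear_0 intro: convex_linear_vimage)
  qed
  ultimately show ?thesis using top by (simp add: lcs_def)
qed


subsection \<open>The universal property for targets of every type\<close>

theorem free_lcs_universal:
  fixes X :: "'x topology" and L :: "'v::real_vector topology"
  assumes free: "free_lcs X L i"
  shows "lcs_universal TYPE('e::real_vector) X L i"
  unfolding lcs_universal_def
proof (intro allI impI, elim conjE)
  fix E :: "'e topology" and f assume E: "lcs E" and f: "continuous_map X E f"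
  define A where "A = topspace X"
  obtain B where B: "B \<subseteq> f ` A" "independent B" "f ` A \<subseteq> span B"
    using maximal_independent_subset[of "f ` A"] by blast
  define s where "s = inv_into A f"
  have s: "s b \<in> A" "f (s b) = b" if "b \<in> B" for b
    using that B(1) by (auto simp: s_def inv_into_into f_inv_into_f)
  define D where "D = real_vector.extend_basis B"
  note D = extend_basis_superset[OF B(2)] independent_extend_basis[OF B(2)]
    span_extend_basis[OF B(2)]
  define r :: "'e \<Rightarrow> 'x \<Rightarrow> real"
    where "r v x = (if x \<in> s ` B then representation D v (f x) else 0)" for v x
  have r: "linear r"
    using D by (intro linearI) (auto simp: fun_eq_iff r_def D_def representation_add representation_scale)
  have "inj_on r (span B)"
  proof (subst linear_inj_on_iff_eq_0[OF r subspace_span], intro ballI impI)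
    fix v assume v: "v \<in> span B" "r v = 0"
    have rep: "representation D v = representation B v"
      using D v(1) by (simp add: D_def representation_extend)
    have "representation B v b = 0" if "b \<in> B" for b
      using fun_cong[OF v(2), of "s b"] s[OF that] that rep by (simp add: r_def)
    then have "(\<Sum>b | representation B v b \<noteq> 0. representation B v b *\<^sub>R b) = 0"
      by (intro sum.neutral) (auto dest: representation_ne_zero)
    then show "v = 0" using sum_nonzero_representation_eq[OF B(2) v(1)] by simp
  qed
  then obtain h where h: "linear h" "\<And>v. v \<in> span B \<Longrightarrow> h (r v) = v"
    using linear_exists_left_inverse_on[OF r subspace_span] by blast
  define k where "k w = (h w, w - r (h w))" for w
  have k: "linear k"
    using h(1) r by (intro linearI)
      (simp_all add: k_def linear_add linear_cmul scaleR_diff_right algebra_simps)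
  have inj: "inj k"
    by (rule injI) (auto simp: k_def)
  define V where "V = pullback_topology UNIV k (prod_topology E (powertop_real (UNIV :: 'x set)))"
  have V: "lcs V" unfolding V_def by (intro lcs_pullback lcs_prod E lcs_powertop_real k inj)
  have "continuous_map V (prod_topology E (powertop_real UNIV)) (id \<circ> k)"
    unfolding V_def by (rule continuous_map_pullback) simp
  then have hV: "continuous_map V E h"
    using continuous_map_compose[OF _ continuous_map_fst] by (fastforce simp: o_def k_def)
  have kr: "k (r (f x)) = (f x, 0)" if "x \<in> A" for x
    using h(2)[of "f x"] B(3) that by (auto simp: k_def)
  have "continuous_map X (prod_topology E (powertop_real (UNIV :: 'x set))) (\<lambda>x. (f x, 0))"
    using f by (intro continuous_map_pairedI) auto
  then have "continuous_map X (prod_topology E (powertop_real UNIV)) (k \<circ> (\<lambda>x. r (f x)))"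
    by (rule continuous_map_eq) (simp add: kr A_def)
  then have "continuous_map X V (\<lambda>x. r (f x))"
    unfolding V_def by (rule continuous_map_pullback') simp
  then obtain F where F: "linear F" "continuous_map L V F" "\<And>x. x \<in> A \<Longrightarrow> F (i x) = r (f x)"
    using free V unfolding free_lcs_def lcs_universal_def A_def by metis
  show "\<exists>!G. linear G \<and> continuous_map L E G \<and> (\<forall>x\<in>topspace X. G (i x) = f x)"
  proof (rule ex1I)
    show "linear (h \<circ> F) \<and> continuous_map L E (h \<circ> F) \<and> (\<forall>x\<in>topspace X. (h \<circ> F) (i x) = f x)"
      using F h B(3) hV by (auto simp: A_def intro: linear_compose continuous_map_compose)
  next
    have "G v = G' v" if G: "linear G" "continuous_map L E G" "\<forall>x\<in>A. G (i x) = f x"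
      and G': "linear G'" "continuous_map L E G'" "\<forall>x\<in>A. G' (i x) = f x" for G G' v
    proof (rule ccontr)
      assume "G v \<noteq> G' v"
      then obtain \<phi> where \<phi>: "linear \<phi>" "continuous_map E euclideanreal \<phi>" "\<phi> (G v - G' v) \<noteq> 0"
        using lcs_dual_separates[OF E, of "G v - G' v"] by (auto simp: dual_def)
      define lift where "lift H = (\<lambda>w (x::'x). \<phi> (H w))" for H :: "'v \<Rightarrow> 'e"
      have lift: "linear (lift H) \<and> continuous_map L (powertop_real UNIV) (lift H) \<and>
          (\<forall>x\<in>topspace X. lift H (i x) = (\<lambda>_. \<phi> (f x)))"
        if H: "linear H" "continuous_map L E H" "\<forall>x\<in>A. H (i x) = f x" for H
      proof (intro conjI)
        show "linear (lift H)"
          using H(1) \<phi>(1) by (intro linearI) (simp_all add: lift_def fun_eq_iff linear_add linear_cmul)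
        show "continuous_map L (powertop_real UNIV) (lift H)"
          using continuous_map_compose[OF H(2) \<phi>(2)]
          by (simp add: continuous_map_componentwise_UNIV lift_def o_def)
        show "\<forall>x\<in>topspace X. lift H (i x) = (\<lambda>_. \<phi> (f x))"
          using H(3) by (simp add: lift_def A_def)
      qed
      have "continuous_map X (powertop_real (UNIV :: 'x set)) (\<lambda>x _. \<phi> (f x))"
        using continuous_map_compose[OF f \<phi>(2)]
        by (simp add: continuous_map_componentwise_UNIV o_def)
      then have "\<exists>!H. linear H \<and> continuous_map L (powertop_real (UNIV :: 'x set)) H \<and>
          (\<forall>x\<in>topspace X. H (i x) = (\<lambda>_. \<phi> (f x)))"
        using free lcs_powertop_real unfolding free_lcs_def lcs_universal_def by blast
      then have "lift G = lift G'" using lift[OF G] lift[OF G'] by blast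
      then have "\<phi> (G v) = \<phi> (G' v)" by (simp add: lift_def fun_eq_iff)
      then show False using \<phi> by (simp add: linear_diff)
    qed
    moreover have "linear (h \<circ> F) \<and> continuous_map L E (h \<circ> F) \<and> (\<forall>x\<in>A. (h \<circ> F) (i x) = f x)"
      using F h B(3) hV by (auto intro: linear_compose continuous_map_compose)
    ultimately show "G = h \<circ> F"
      if "linear G \<and> continuous_map L E G \<and> (\<forall>x\<in>topspace X. G (i x) = f x)" for G
      using that unfolding A_def[symmetric] by blast
  qed
qed

end

theory Submission
  imports Defs
begin

text \<open>A continuous functional \<open>\<phi>\<close> on the free space \<open>L\<close> is the same thing as a continuous
  function \<open>\<phi> \<circ> i\<close> on \<open>X\<close>, so all three claims are about sequences of continuous functions on
  \<open>X\<close>. The dictionary needs one nontrivial entry: a sequence of functionals is equicontinuous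
  on \<open>L\<close> as soon as it is pointwise bounded and equicontinuous as a sequence of functions on \<open>X\<close>
  (\<open>free_lcs_equicontinuousI\<close>). Such a sequence is one continuous map from \<open>X\<close> into the Banach space
  of bounded real sequences, and the universal property extends this map to \<open>L\<close>.

  For \<open>c\<^sub>0\<close>-quasibarrelledness, suppose that a strongly null sequence fails to be
  equicontinuous at \<open>x\<close>. As \<open>X\<close> is metrizable, the failure is witnessed along points
  \<open>y\<^sub>k\<close> that tend to \<open>x\<close>. The vectors \<open>i y\<^sub>k - i x\<close> form a null sequence, hence a
  bounded set, on which the functionals tend to zero uniformly; so only finitely many
  functionals can witness the failure, and each of them is continuous at \<open>x\<close>.

  For the two negative claims, let \<open>x\<close> be a non-isolated point and take bumps
  \<open>f\<^sub>n : X \<rightarrow> [0, 1]\<close> of height one at points tending to \<open>x\<close>, vanishing at \<open>x\<close> and tending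
  to zero pointwise (\<open>shrinking_bumps\<close>). The corresponding functionals are not equicontinuous.
  They tend to zero weakly because \<open>i\<close> maps \<open>X\<close> onto a spanning set of \<open>L\<close>
  (\<open>free_lcs_span\<close>). They are strongly bounded because every uniformly bounded sequence of
  functions is (\<open>free_lcs_uniformly_bounded_strong_bounded\<close>): a sequence
  that tends to zero uniformly on \<open>X\<close> is equicontinuous, hence bounded on every bounded subset of
  \<open>L\<close>, and by rescaling this property passes to uniformly bounded sequences.\<close>


section \<open>Neighbourhoods, null sequences and bounded sets\<close>

lemma lcs_nbhd_absorbs:
  assumes T: "lcs T" and C: "openin T C" "0 \<in> C"
  shows "eventually (\<lambda>s::real. (1 / s) *\<^sub>R v \<in> C) at_top"
proof -
  have "continuous_map euclideanreal T (\<lambda>c. c *\<^sub>R v)"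
    using T by (intro lcs_continuous_scaleR) (auto simp: lcs_topspace)
  from openin_continuous_map_preimage[OF this C(1)]
  have op: "open {c::real. c *\<^sub>R v \<in> C}" by simp
  have "((\<lambda>s::real. 1 / s) \<longlongrightarrow> 0) at_top"
    by (intro tendsto_divide_0[OF tendsto_const] filterlim_at_top_imp_at_infinity filterlim_ident)
  from topological_tendstoD[OF this op] C(2) show ?thesis by simp
qed

lemma mem_scaled_image:
  fixes v :: "'v::real_vector"
  assumes "s > 0" "(1 / s) *\<^sub>R v \<in> U"
  shows "v \<in> (*\<^sub>R) s ` U"
  using assms by (intro image_eqI[of _ _ "(1 / s) *\<^sub>R v"]) auto

lemma bounded_in_singleton:
  assumes T: "lcs T"
  shows "bounded_in T {v}"
  unfolding bounded_in_def
proof (intro conjI allI impI)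
  fix U assume "openin T U \<and> 0 \<in> U"
  then have "eventually (\<lambda>s::real. s > 0 \<and> (1 / s) *\<^sub>R v \<in> U) at_top"
    by (intro eventually_conj eventually_gt_at_top lcs_nbhd_absorbs[OF T]) auto
  then obtain s :: real where "s > 0" "(1 / s) *\<^sub>R v \<in> U"
    using eventually_happens'[OF trivial_limit_at_top_linorder] by blast
  then show "\<exists>r>0. {v} \<subseteq> (*\<^sub>R) r ` U"
    using mem_scaled_image by (metis singletonD subsetI)
qed (simp add: lcs_topspace[OF T])

text \<open>A convex neighbourhood \<open>C\<close> of zero contains a tail of the sequence, and shrinking keeps the tail in
  \<open>C\<close>; the finitely many remaining terms are absorbed one by one.\<close>

lemma bounded_in_null_sequence:
  assumes T: "lcs T" and \<sigma>: "limitin T \<sigma> 0 sequentially"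
  shows "bounded_in T (range \<sigma>)"
  unfolding bounded_in_def
proof (intro conjI allI impI)
  fix U assume "openin T U \<and> 0 \<in> U"
  then obtain C where C: "openin T C" "0 \<in> C" "convex C" "C \<subseteq> U"
    using T lcs_convexE by metis
  then obtain N where N: "\<And>n. n \<ge> N \<Longrightarrow> \<sigma> n \<in> C"
    using \<sigma> by (metis limitin_sequentially)
  have "eventually (\<lambda>s::real. s \<ge> 1 \<and> (\<forall>n\<in>{..<N}. (1 / s) *\<^sub>R \<sigma> n \<in> C)) at_top"
    using lcs_nbhd_absorbs[OF T C(1,2)]
    by (intro eventually_conj eventually_ge_at_top eventually_ball_finite) auto
  then obtain s :: real where s: "s \<ge> 1" "\<And>n. n < N \<Longrightarrow> (1 / s) *\<^sub>R \<sigma> n \<in> C"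
    using eventually_happens'[OF trivial_limit_at_top_linorder] by blast
  have "(1 / s) *\<^sub>R \<sigma> n \<in> C" for n
  proof (cases "n < N")
    case False
    then have "(1 / s) *\<^sub>R \<sigma> n + (1 - 1 / s) *\<^sub>R 0 \<in> C"
      using s(1) by (intro convexD[OF C(3) N C(2)]) auto
    then show ?thesis by simp
  qed (simp add: s)
  then have "range \<sigma> \<subseteq> (*\<^sub>R) s ` U" using s(1) C(4) mem_scaled_image[of s] by fastforce
  then show "\<exists>r>0. range \<sigma> \<subseteq> (*\<^sub>R) r ` U" using s(1) by (intro exI[of _ s]) auto
qed (simp add: lcs_topspace[OF T])

lemma lcs_euclidean: "lcs (euclidean :: 'a::real_normed_vector topology)"
proof -
  have "continuous_map (prod_topology euclidean euclidean) euclidean (\<lambda>(x::'a, y). x + y)"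
    by (auto simp flip: euclidean_product_topology simp: case_prod_unfold intro!: continuous_intros)
  moreover have "continuous_map (prod_topology euclideanreal euclidean) euclidean (\<lambda>(c, x::'a). c *\<^sub>R x)"
    by (auto simp flip: euclidean_product_topology simp: case_prod_unfold intro!: continuous_intros)
  moreover have "\<exists>C. open C \<and> 0 \<in> C \<and> convex C \<and> C \<subseteq> U" if "open U" "0 \<in> U" for U :: "'a set"
    using that open_contains_ball[of U] by (metis open_ball centre_in_ball convex_ball)
  ultimately show ?thesis by (simp add: lcs_def Hausdorff_space_euclidean)
qed


section \<open>Equicontinuity and the strong dual\<close>

lemma dual_linear: "\<phi> \<in> dual T \<Longrightarrow> linear \<phi>"
  by (simp add: dual_def)

lemma scaleR_in_dual:
  assumes "\<phi> \<in> dual T"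
  shows "(\<lambda>v. c * \<phi> v) \<in> dual T"
  using assms unfolding dual_def
  by (auto intro!: linearI continuous_map_real_mult simp: linear_add linear_cmul algebra_simps)

lemma equicontinuous_imp_bounded:
  assumes A: "equicontinuous T A" and B: "bounded_in T B"
  shows "\<exists>r. \<forall>\<phi>\<in>A. \<forall>b\<in>B. \<bar>\<phi> b\<bar> \<le> r"
proof -
  obtain U where U: "openin T U" "0 \<in> U" "A \<subseteq> polar T U"
    using A unfolding equicontinuous_def by blast
  obtain r where r: "r > 0" "B \<subseteq> (*\<^sub>R) r ` U" using B U(1,2) unfolding bounded_in_def by blast
  have "\<bar>\<phi> b\<bar> \<le> r" if mem: "\<phi> \<in> A" "b \<in> B" for \<phi> b
  proof -
    obtain u where u: "u \<in> U" "b = r *\<^sub>R u" using r(2) mem(2) by blast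
    have \<phi>: "\<phi> \<in> dual T" "\<bar>\<phi> u\<bar> \<le> 1" using U(3) u(1) mem(1) by (auto simp: polar_def)
    then have "\<bar>\<phi> b\<bar> = r * \<bar>\<phi> u\<bar>"
      using r(1) u(2) by (simp add: linear_cmul[OF dual_linear] abs_mult)
    then show ?thesis using \<phi>(2) r(1) by (simp add: mult_left_le)
  qed
  then show ?thesis by blast
qed

text \<open>Equicontinuity at zero is uniform equicontinuity, by linearity: the bound 1 on \<open>U\<close>
  becomes the bound \<open>e\<close> on the translate \<open>i x + e U\<close>, which is then pulled back along \<open>i\<close>.\<close>

lemma equicontinuous_comp:
  assumes T: "lcs T" and A: "equicontinuous T A" and i: "continuous_map X T i"
    and x: "x \<in> topspace X" and e: "e > 0"
  shows "\<exists>V. openin X V \<and> x \<in> V \<and> (\<forall>y\<in>V. \<forall>\<phi>\<in>A. \<bar>\<phi> (i y) - \<phi> (i x)\<bar> \<le> e)"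
proof -
  obtain U where U: "openin T U" "0 \<in> U" "A \<subseteq> polar T U"
    using A unfolding equicontinuous_def by blast
  define V where "V = {y \<in> topspace X. i y \<in> {w. (1 / e) *\<^sub>R (w + (- i x)) \<in> U}}"
  have "openin X V"
    unfolding V_def by (intro openin_continuous_map_preimage[OF i] lcs_openin_affine T U(1))
  moreover have "x \<in> V" using x U(2) by (simp add: V_def)
  moreover have "\<bar>\<phi> (i y) - \<phi> (i x)\<bar> \<le> e" if "y \<in> V" "\<phi> \<in> A" for y \<phi>
  proof -
    have \<phi>: "\<phi> \<in> dual T" "\<bar>\<phi> ((1 / e) *\<^sub>R (i y - i x))\<bar> \<le> 1"
      using that U(3) by (auto simp: polar_def V_def)
    have "\<phi> ((1 / e) *\<^sub>R (i y - i x)) = (\<phi> (i y) - \<phi> (i x)) / e"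
      using dual_linear[OF \<phi>(1)] by (simp only: linear_cmul linear_diff) simp
    then show ?thesis using \<phi>(2) e by (simp add: divide_le_eq)
  qed
  ultimately show ?thesis by blast
qed

lemma topspace_strong_dual:
  assumes T: "lcs T"
  shows "topspace (strong_dual T) = dual T"
proof
  show "topspace (strong_dual T) \<subseteq> dual T"
    using openin_strong_dual[OF T] openin_topspace by blast
  have "\<exists>B e. bounded_in T B \<and> (e::real) > 0 \<and>
      {\<psi> \<in> dual T. \<forall>x\<in>B. \<bar>\<psi> x - \<phi> x\<bar> \<le> e} \<subseteq> dual T" for \<phi>
    using bounded_in_singleton[OF T, of 0] by (intro exI[of _ "{0}"] exI[of _ 1]) auto
  then have "openin (strong_dual T) (dual T)" by (simp add: openin_strong_dual[OF T])
  then show "dual T \<subseteq> topspace (strong_dual T)" by (rule openin_subset)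
qed

text \<open>The basic sets \<open>{\<psi>. \<bar>\<psi>\<bar> \<le> e on B}\<close> that describe the strong topology need not be open. The set
  of functionals whose supremum on \<open>B\<close> is strictly below \<open>e\<close> is open and lies inside.\<close>

lemma strong_null_uniform:
  assumes T: "lcs T" and \<phi>: "limitin (strong_dual T) \<phi> 0 sequentially"
    and B: "bounded_in T B" and e: "e > 0"
  shows "\<exists>N. \<forall>n\<ge>N. \<forall>b\<in>B. \<bar>\<phi> n b\<bar> \<le> e"
proof -
  define W where "W = {\<psi> \<in> dual T. \<exists>d<e. \<forall>b\<in>B. \<bar>\<psi> b\<bar> \<le> d}"
  have "\<exists>B e. bounded_in T B \<and> e > 0 \<and> {\<theta> \<in> dual T. \<forall>x\<in>B. \<bar>\<theta> x - \<psi> x\<bar> \<le> e} \<subseteq> W"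
    if "\<psi> \<in> W" for \<psi>
  proof -
    obtain d where d: "d < e" "\<forall>b\<in>B. \<bar>\<psi> b\<bar> \<le> d" using \<open>\<psi> \<in> W\<close> by (auto simp: W_def)
    have "\<theta> \<in> W" if \<theta>: "\<theta> \<in> dual T" "\<forall>x\<in>B. \<bar>\<theta> x - \<psi> x\<bar> \<le> (e - d) / 2" for \<theta>
    proof -
      have "\<bar>\<theta> b\<bar> \<le> d + (e - d) / 2" if "b \<in> B" for b
        using bspec[OF \<theta>(2) that] bspec[OF d(2) that] by linarith
      moreover have "d + (e - d) / 2 < e" using d(1) by (simp add: field_simps)
      ultimately show ?thesis using \<theta>(1) unfolding W_def by blast
    qed
    then show ?thesis using B d(1) by (intro exI[of _ B] exI[of _ "(e - d) / 2"]) auto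
  qed
  then have "openin (strong_dual T) W" by (simp add: openin_strong_dual[OF T] W_def)
  moreover have "0 \<in> dual T"
    using \<phi> topspace_strong_dual[OF T] by (auto simp: limitin_def)
  then have "0 \<in> W" using e by (auto simp: W_def)
  ultimately obtain N where "\<And>n. n \<ge> N \<Longrightarrow> \<phi> n \<in> W"
    using \<phi> by (metis limitin_sequentially)
  then show ?thesis unfolding W_def by fastforce
qed

lemma strong_bounded:
  assumes T: "lcs T" and A: "A \<subseteq> dual T"
    and bd: "\<And>B. bounded_in T B \<Longrightarrow> \<exists>r. \<forall>\<phi>\<in>A. \<forall>b\<in>B. \<bar>\<phi> b\<bar> \<le> r"
  shows "bounded_in (strong_dual T) A"
  unfolding bounded_in_def
proof (intro conjI allI impI)
  show "A \<subseteq> topspace (strong_dual T)" using A topspace_strong_dual[OF T] by simp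
  fix W assume W: "openin (strong_dual T) W \<and> 0 \<in> W"
  then obtain B e where Be: "bounded_in T B" "e > 0"
    "{\<psi> \<in> dual T. \<forall>x\<in>B. \<bar>\<psi> x - (0 :: 'a \<Rightarrow> real) x\<bar> \<le> e} \<subseteq> W"
    unfolding openin_strong_dual[OF T] by blast
  obtain r where r: "\<And>\<phi> b. \<phi> \<in> A \<Longrightarrow> b \<in> B \<Longrightarrow> \<bar>\<phi> b\<bar> \<le> r" using bd[OF Be(1)] by blast
  define s where "s = max r 1 / e"
  have s: "s > 0" using Be(2) by (simp add: s_def)
  have "\<phi> \<in> (*\<^sub>R) s ` W" if \<phi>: "\<phi> \<in> A" for \<phi>
  proof (rule mem_scaled_image[OF s], rule subsetD[OF Be(3)], intro CollectI conjI ballI)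
    have "(1 / s) *\<^sub>R \<phi> = (\<lambda>v. (1 / s) * \<phi> v)" by (simp add: fun_eq_iff)
    then show "(1 / s) *\<^sub>R \<phi> \<in> dual T" using scaleR_in_dual[of \<phi> T "1 / s"] A \<phi> by auto
    fix b assume "b \<in> B"
    then have "\<bar>\<phi> b\<bar> \<le> s * e" using r[OF \<phi>] Be(2) by (fastforce simp: s_def)
    then show "\<bar>((1 / s) *\<^sub>R \<phi>) b - 0 b\<bar> \<le> e"
      using s by (simp add: abs_mult divide_le_eq mult.commute)
  qed
  then show "\<exists>r>0. A \<subseteq> (*\<^sub>R) r ` W" using s by blast
qed


section \<open>Free locally convex spaces\<close>

lemma free_lcs_extend:
  fixes f :: "'x \<Rightarrow> 'e::real_vector"
  assumes "free_lcs X L i" "lcs E" "continuous_map X E f"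
  obtains F where "linear F" "continuous_map L E F" "\<And>x. x \<in> topspace X \<Longrightarrow> F (i x) = f x"
  using free_lcs_universal[OF assms(1), where ?'e = 'e] assms(2,3)
  unfolding lcs_universal_def by (metis (no_types, lifting))

lemma free_lcs_unique:
  fixes F G :: "'v::real_vector \<Rightarrow> 'e::real_vector"
  assumes free: "free_lcs X L i" and E: "lcs E"
    and F: "linear F" "continuous_map L E F" and G: "linear G" "continuous_map L E G"
    and eq: "\<And>x. x \<in> topspace X \<Longrightarrow> F (i x) = G (i x)"
  shows "F = G"
proof -
  have "continuous_map X L i" using free by (simp add: free_lcs_def)
  from continuous_map_compose[OF this F(2)]
  have "\<exists>!H. linear H \<and> continuous_map L E H \<and> (\<forall>x\<in>topspace X. H (i x) = (F \<circ> i) x)"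
    using free_lcs_universal[OF free, where ?'e = 'e] E unfolding lcs_universal_def by blast
  then show ?thesis using F G eq by (metis comp_apply)
qed

text \<open>The uniqueness part of the universal property only says that the span \<open>M\<close> of the image is
  dense. To see that \<open>M\<close> is everything, refine the topology of \<open>L\<close> so that a linear projection \<open>P\<close> onto
  \<open>M\<close> becomes continuous. The map \<open>i\<close> stays continuous, because \<open>P\<close> fixes its values, and so extends to
  an operator \<open>F\<close>. Then \<open>P \<circ> F\<close> and the identity agree on the image of \<open>i\<close>, so they are equal
  and \<open>P\<close> is onto.\<close>

lemma free_lcs_span:
  fixes L :: "'v::real_vector topology"
  assumes free: "free_lcs X L i"
  shows "span (i ` topspace X) = UNIV"
proof -
  let ?M = "span (i ` topspace X)"
  have L: "lcs L" and i: "continuous_map X L i" using free by (simp_all add: free_lcs_def)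
  obtain P :: "'v \<Rightarrow> 'v" where P: "range P \<subseteq> ?M" "linear P" "\<And>v. v \<in> ?M \<Longrightarrow> P v = v"
    using linear_exists_left_inverse_on[OF linear_id subspace_span inj_on_id, of "i ` topspace X"]
    by auto
  \<comment> \<open>Pulling the product topology back along \<open>k\<close> makes both \<open>P\<close> and the complementary projection
    continuous; the second component makes \<open>k\<close> injective, which keeps the topology Hausdorff.\<close>
  define k where "k v = (P v, v - P v)" for v
  have k: "linear k" "inj k"
    using P(2) by (auto intro!: linearI injI
        simp: k_def linear_add linear_cmul scaleR_diff_right algebra_simps)
  define E where "E = pullback_topology UNIV k (prod_topology L L)"
  have E: "lcs E" unfolding E_def by (intro lcs_pullback lcs_prod L k)
  have ki: "k (i x) = (i x, 0)" if "x \<in> topspace X" for x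
    using P(3)[of "i x"] that by (simp add: k_def span_base)
  have "continuous_map X (prod_topology L L) (\<lambda>x. (i x, 0))"
    using i by (intro continuous_map_pairedI) (auto simp: lcs_topspace[OF L])
  then have "continuous_map X (prod_topology L L) (k \<circ> i)"
    by (rule continuous_map_eq) (simp add: ki)
  then have "continuous_map X E i" unfolding E_def by (rule continuous_map_pullback') simp
  then obtain F where F: "linear F" "continuous_map L E F" "\<And>x. x \<in> topspace X \<Longrightarrow> F (i x) = i x"
    using free_lcs_extend[OF free E] by blast
  have "continuous_map E (prod_topology L L) (id \<circ> k)"
    unfolding E_def by (rule continuous_map_pullback) simp
  then have "continuous_map E L P"
    using continuous_map_compose[OF _ continuous_map_fst] by (fastforce simp: o_def k_def)
  then have "P \<circ> F = id"
    using F P(2,3) by (intro free_lcs_unique[OF free L] linear_compose linear_id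
        continuous_map_compose[OF F(2)]) (auto simp: span_base)
  then have "v = P (F v)" for v by (metis comp_apply id_apply)
  then show ?thesis using P(1) by blast
qed

text \<open>The two hypotheses say exactly that \<open>x \<mapsto> (\<phi>\<^sub>n (i x))\<^sub>n\<close> is a continuous map from \<open>X\<close> into the
  bounded sequences with the supremum norm. Its extension \<open>F\<close> to \<open>L\<close> has coordinates \<open>\<phi>\<^sub>n\<close>, so all
  \<open>\<phi>\<^sub>n\<close> are bounded by 1 on the preimage of the unit ball under \<open>F\<close>.\<close>

lemma free_lcs_equicontinuousI:
  fixes \<phi> :: "nat \<Rightarrow> 'v::real_vector \<Rightarrow> real"
  assumes free: "free_lcs X L i" and \<phi>: "range \<phi> \<subseteq> dual L"
    and bd: "\<And>x. x \<in> topspace X \<Longrightarrow> \<exists>r. \<forall>n. \<bar>\<phi> n (i x)\<bar> \<le> r"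
    and eq: "\<And>x e. x \<in> topspace X \<Longrightarrow> e > 0 \<Longrightarrow>
      \<exists>V. openin X V \<and> x \<in> V \<and> (\<forall>y\<in>V. \<forall>n. \<bar>\<phi> n (i y) - \<phi> n (i x)\<bar> \<le> e)"
  shows "equicontinuous L (range \<phi>)"
proof -
  define f :: "'a \<Rightarrow> nat \<Rightarrow>\<^sub>C real" where "f x = Bcontfun (\<lambda>n. \<phi> n (i x))" for x
  have f: "apply_bcontfun (f x) n = \<phi> n (i x)" if x: "x \<in> topspace X" for x n
  proof -
    obtain r where "\<And>n. \<bar>\<phi> n (i x)\<bar> \<le> r" using bd[OF x] by blast
    then have "(\<lambda>n. \<phi> n (i x)) \<in> bcontfun" by (intro bcontfun_normI[of _ r]) simp_all
    then show ?thesis by (simp add: f_def Bcontfun_inverse)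
  qed
  have "openin X {x \<in> topspace X. f x \<in> W}" if "open W" for W
  proof (subst openin_subopen, intro ballI)
    fix x assume "x \<in> {x \<in> topspace X. f x \<in> W}"
    then have x: "x \<in> topspace X" "f x \<in> W" by auto
    obtain e where e: "e > 0" "cball (f x) e \<subseteq> W" using \<open>open W\<close> x(2) open_contains_cball by blast
    obtain V where V: "openin X V" "x \<in> V" "\<forall>y\<in>V. \<forall>n. \<bar>\<phi> n (i y) - \<phi> n (i x)\<bar> \<le> e"
      using eq[OF x(1) e(1)] by blast
    have "f y \<in> W" if "y \<in> V" for y
    proof -
      have "y \<in> topspace X" using that openin_subset[OF V(1)] by blast
      then have "dist (f x) (f y) \<le> e"
        using V(3) that x(1) by (intro dist_bound) (subst dist_commute, simp add: f dist_real_def)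
      then show ?thesis using e(2) by auto
    qed
    then show "\<exists>V. openin X V \<and> x \<in> V \<and> V \<subseteq> {x \<in> topspace X. f x \<in> W}"
      using V(1,2) openin_subset[OF V(1)] by (intro exI[of _ V]) auto
  qed
  then have "continuous_map X euclidean f" by (simp add: continuous_map_def)
  then obtain F where F: "linear F" "continuous_map L euclidean F"
      "\<And>x. x \<in> topspace X \<Longrightarrow> F (i x) = f x"
    using free_lcs_extend[OF free lcs_euclidean] by blast
  \<comment> \<open>Both sides are continuous functionals of \<open>v\<close> that agree on the image of \<open>i\<close>.\<close>
  have F\<phi>: "apply_bcontfun (F v) n = \<phi> n v" for v n
  proof -
    have "(\<lambda>v. apply_bcontfun (F v) n) = \<phi> n"
    proof (rule free_lcs_unique[OF free lcs_euclidean])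
      show "linear (\<lambda>v. apply_bcontfun (F v) n)"
        using F(1) by (intro linearI) (simp_all add: linear_add linear_cmul)
      have "continuous_on UNIV (\<lambda>g :: nat \<Rightarrow>\<^sub>C real. apply_bcontfun g n)"
        unfolding continuous_on_iff
      proof (intro ballI allI impI)
        fix g :: "nat \<Rightarrow>\<^sub>C real" and e :: real assume "e > 0"
        then show "\<exists>d>0. \<forall>h\<in>UNIV. dist h g < d \<longrightarrow> dist (apply_bcontfun h n) (apply_bcontfun g n) < e"
          using dist_fun_lt_imp_dist_val_lt by blast
      qed
      then show "continuous_map L euclidean (\<lambda>v. apply_bcontfun (F v) n)"
        using continuous_map_compose[OF F(2), of euclidean "\<lambda>g. apply_bcontfun g n"]
        by (simp add: o_def)
    qed (use \<phi> F(3) f in \<open>auto simp: dual_def\<close>)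
    then show ?thesis by (rule fun_cong)
  qed
  define U where "U = {v \<in> topspace L. F v \<in> ball 0 1}"
  have "openin L U" unfolding U_def by (rule openin_continuous_map_preimage[OF F(2)]) simp
  moreover have "0 \<in> U"
    using free F(1) by (simp add: U_def free_lcs_def lcs_topspace linear_0)
  moreover have "\<bar>\<phi> n v\<bar> \<le> 1" if "v \<in> U" for n v
    using that norm_bounded[of "F v" n] by (simp add: U_def F\<phi>)
  ultimately show ?thesis using \<phi> unfolding equicontinuous_def polar_def by blast
qed

text \<open>At a given point and up to a given error, uniform smallness handles all but finitely many
  functionals, and continuity handles the others.\<close>

lemma free_lcs_uniformly_null_equicontinuous:
  fixes \<psi> :: "nat \<Rightarrow> 'v::real_vector \<Rightarrow> real"
  assumes free: "free_lcs X L i" and \<psi>: "range \<psi> \<subseteq> dual L"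
    and c: "c \<longlonglongrightarrow> 0" "\<And>n x. x \<in> topspace X \<Longrightarrow> \<bar>\<psi> n (i x)\<bar> \<le> c n"
  shows "equicontinuous L (range \<psi>)"
proof (rule free_lcs_equicontinuousI[OF free \<psi>])
  have i: "continuous_map X L i" using free by (simp add: free_lcs_def)
  have cont: "continuous_map X euclideanreal (\<lambda>y. \<psi> n (i y))" for n
    using continuous_map_compose[OF i, of euclideanreal "\<psi> n"] \<psi> by (auto simp: dual_def o_def)
  obtain C where C: "\<And>n. \<bar>c n\<bar> \<le> C"
    using convergent_imp_Bseq[OF convergentI[OF c(1)]] by (auto simp: Bseq_def)
  fix x assume x: "x \<in> topspace X"
  have "\<bar>\<psi> n (i x)\<bar> \<le> C" for n using c(2)[OF x, of n] C[of n] by linarith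
  then show "\<exists>r. \<forall>n. \<bar>\<psi> n (i x)\<bar> \<le> r" by blast
  fix e :: real assume e: "e > 0"
  then have "eventually (\<lambda>n. c n < e / 2) sequentially" by (intro order_tendstoD[OF c(1)]) simp
  then obtain N where N: "\<And>n. n \<ge> N \<Longrightarrow> c n < e / 2" by (auto simp: eventually_sequentially)
  define V where "V = (\<Inter>n\<in>{..N}. {y \<in> topspace X. \<psi> n (i y) \<in> ball (\<psi> n (i x)) e})"
  have "openin X V"
    unfolding V_def by (intro openin_INT2 openin_continuous_map_preimage[OF cont]) auto
  moreover have "x \<in> V" using x e by (simp add: V_def)
  moreover have "\<bar>\<psi> n (i y) - \<psi> n (i x)\<bar> \<le> e" if y: "y \<in> V" for y n
  proof (cases "n \<le> N")
    case True
    then have "\<psi> n (i y) \<in> ball (\<psi> n (i x)) e" using y by (simp add: V_def)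
    then show ?thesis by (simp add: dist_real_def abs_minus_commute)
  next
    case False
    have "y \<in> topspace X" using y by (auto simp: V_def)
    then show ?thesis using c(2)[OF x, of n] c(2)[of y n] N[of n] False by linarith
  qed
  ultimately show "\<exists>V. openin X V \<and> x \<in> V \<and> (\<forall>y\<in>V. \<forall>n. \<bar>\<psi> n (i y) - \<psi> n (i x)\<bar> \<le> e)"
    by blast
qed

text \<open>If the functionals were unbounded on a bounded set \<open>B\<close>, then some of them would reach
  values above \<open>(k + 1)\<^sup>2\<close> on \<open>B\<close> for each \<open>k\<close>. Divided by \<open>k + 1\<close> these still are unbounded on \<open>B\<close>,
  but they tend to zero uniformly on \<open>X\<close> and hence are equicontinuous. This rescaling takes the place of the
  uniform boundedness principle.\<close>

lemma free_lcs_uniformly_bounded_strong_bounded: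
  fixes \<phi> :: "nat \<Rightarrow> 'v::real_vector \<Rightarrow> real"
  assumes free: "free_lcs X L i" and \<phi>: "range \<phi> \<subseteq> dual L"
    and c: "\<And>n x. x \<in> topspace X \<Longrightarrow> \<bar>\<phi> n (i x)\<bar> \<le> c"
  shows "bounded_in (strong_dual L) (range \<phi>)"
proof (rule strong_bounded[OF _ \<phi>])
  show "lcs L" using free by (simp add: free_lcs_def)
  fix B assume B: "bounded_in L B"
  show "\<exists>r. \<forall>\<psi>\<in>range \<phi>. \<forall>b\<in>B. \<bar>\<psi> b\<bar> \<le> r"
  proof (rule ccontr)
    assume "\<not> ?thesis"
    then have "\<exists>n b. b \<in> B \<and> \<bar>\<phi> n b\<bar> > r" for r by (simp add: not_le Bex_def)
    then have "\<exists>n b. b \<in> B \<and> \<bar>\<phi> n b\<bar> > (real k + 1)^2" for k :: nat by blast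
    then obtain n b where nb: "\<And>k. b k \<in> B" "\<And>k. \<bar>\<phi> (n k) (b k)\<bar> > (real k + 1)^2" by metis
    define \<psi> where "\<psi> k v = (1 / (real k + 1)) * \<phi> (n k) v" for k v
    have "\<psi> k \<in> dual L" for k
      unfolding \<psi>_def[abs_def] by (rule scaleR_in_dual) (use \<phi> in blast)
    then have "range \<psi> \<subseteq> dual L" by blast
    moreover have "(\<lambda>k. c / (real k + 1)) \<longlonglongrightarrow> 0"
      using tendsto_mult_right_zero[OF LIMSEQ_inverse_real_of_nat, of c]
      by (simp add: field_simps)
    moreover have "\<bar>\<psi> k (i x)\<bar> \<le> c / (real k + 1)" if "x \<in> topspace X" for k x
      using c[OF that, of "n k"] by (simp add: \<psi>_def abs_mult divide_right_mono)
    ultimately have "equicontinuous L (range \<psi>)"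
      by (rule free_lcs_uniformly_null_equicontinuous[OF free])
    then obtain r where r: "\<And>k. \<bar>\<psi> k (b k)\<bar> \<le> r"
      using equicontinuous_imp_bounded[OF _ B] nb(1) by blast
    have "real k + 1 < r" for k
    proof -
      have "(real k + 1) * (real k + 1) < \<bar>\<phi> (n k) (b k)\<bar>" using nb(2)[of k] by (simp add: power2_eq_square)
      then have "real k + 1 < \<bar>\<phi> (n k) (b k)\<bar> / (real k + 1)" by (simp add: less_divide_eq)
      also have "\<dots> = \<bar>\<psi> k (b k)\<bar>" by (simp add: \<psi>_def abs_mult)
      finally show ?thesis using r[of k] by linarith
    qed
    then show False using reals_Archimedean2[of r] by (meson less_add_one less_trans not_less_iff_gr_or_eq)
  qed
qed

lemma free_lcs_weak_null:
  fixes L :: "'v::real_vector topology"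
  assumes free: "free_lcs X L i" and \<phi>: "range \<phi> \<subseteq> dual L"
    and null: "\<And>x. x \<in> topspace X \<Longrightarrow> (\<lambda>n. \<phi> n (i x)) \<longlonglongrightarrow> 0"
  shows "limitin (weak_dual L) \<phi> 0 sequentially"
proof -
  have lin: "linear (\<phi> n)" for n using \<phi> by (auto simp: dual_def)
  have "(\<lambda>n. \<phi> n v) \<longlonglongrightarrow> 0" if "v \<in> span (i ` topspace X)" for v
    using that
  proof (induction rule: span_induct_alt)
    case base
    then show ?case by (simp add: linear_0[OF lin])
  next
    case (step c w v)
    then have "(\<lambda>n. c * \<phi> n w + \<phi> n v) \<longlonglongrightarrow> c * 0 + 0"
      by (intro tendsto_intros) (auto intro: null)
    then show ?case by (simp add: linear_add[OF lin] linear_cmul[OF lin])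
  qed
  then have "limitin (powertop_real UNIV) \<phi> 0 sequentially"
    using free_lcs_span[OF free] by (simp add: limitin_componentwise)
  moreover have "0 \<in> dual L" by (auto simp: dual_def zero_fun_def intro: linear_zero)
  ultimately show ?thesis using \<phi> by (simp add: weak_dual_def limitin_subtopology image_subset_iff)
qed


section \<open>Bump functions at a non-isolated point\<close>

text \<open>The bump at \<open>p\<^sub>n\<close> has radius \<open>d p\<^sub>n x\<close>, the largest for which it still vanishes at \<open>x\<close>. As
  the centres tend to \<open>x\<close> and the radii to zero, the bumps eventually leave every other point.\<close>

lemma (in Metric_space) shrinking_bumps:
  assumes x: "x \<in> M" and iso: "\<not> openin mtopology {x}"
  obtains f :: "nat \<Rightarrow> 'a \<Rightarrow> real" and p where
    "\<And>n. continuous_map mtopology euclideanreal (f n)"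
    "\<And>n y. 0 \<le> f n y \<and> f n y \<le> 1"
    "\<And>y. y \<in> M \<Longrightarrow> (\<lambda>n. f n y) \<longlonglongrightarrow> 0"
    "\<And>n. f n x = 0" "\<And>n. f n (p n) = 1"
    "limitin mtopology p x sequentially"
proof -
  have "\<exists>y. y \<in> mball x (inverse (real (Suc n))) \<and> y \<noteq> x" for n
  proof (rule ccontr)
    assume "\<not> ?thesis"
    then have "mball x (inverse (real (Suc n))) = {x}" using x by auto
    then show False using iso openin_mball[of x "inverse (real (Suc n))"] by simp
  qed
  then obtain p where p: "\<And>n. p n \<in> mball x (inverse (real (Suc n)))" "\<And>n. p n \<noteq> x" by metis
  have pM: "p n \<in> M" and dp: "d (p n) x < inverse (real (Suc n))" for n
    using p(1)[of n] commute[of "p n" x] by auto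
  have pos: "d (p n) x > 0" for n using p(2) pM x by simp
  have lim: "(\<lambda>n. d (p n) x) \<longlonglongrightarrow> 0"
    using less_imp_le[OF dp]
    by (intro tendsto_sandwich[OF always_eventually always_eventually
          tendsto_const LIMSEQ_inverse_real_of_nat]) auto
  define f where "f n y = max 0 (1 - d (p n) y / d (p n) x)" for n y
  show thesis
  proof (rule that[of f p])
    have "continuous_map mtopology euclideanreal (d (p n))" for n
      using continuous_on_mdist[of "p n" Self] pM by (simp add: mtopology_of_def)
    then show "continuous_map mtopology euclideanreal (f n)" for n
      using pos[of n] unfolding f_def
      by (intro continuous_map_real_max continuous_map_diff continuous_map_real_divide) auto
    show "0 \<le> f n y \<and> f n y \<le> 1" for n y by (simp add: f_def)
    show "f n x = 0" "f n (p n) = 1" for n using pos[of n] pM by (auto simp: f_def)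
    show "limitin mtopology p x sequentially"
      using lim x pM by (simp add: limitin_metric_dist_null)
    fix y assume y: "y \<in> M"
    show "(\<lambda>n. f n y) \<longlonglongrightarrow> 0"
    proof (cases "y = x")
      case True
      have "f n x = 0" for n using pos[of n] by (simp add: f_def)
      then show ?thesis using True by simp
    next
      case False
      then have "d x y / 2 > 0" using x y by simp
      then have "eventually (\<lambda>n. d (p n) x < d x y / 2) sequentially"
        by (rule order_tendstoD(2)[OF lim])
      then have "eventually (\<lambda>n. f n y = 0) sequentially"
      proof eventually_elim
        case (elim n)
        have "d x y \<le> d (p n) x + d (p n) y" using triangle[OF x pM[of n] y] commute[of x "p n"] by simp
        then have "1 \<le> d (p n) y / d (p n) x" using elim pos[of n] by (simp add: le_divide_eq)
        then show ?case by (simp add: f_def)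
      qed
      then show ?thesis by (rule tendsto_eventually)
    qed
  qed
qed


section \<open>Barrelledness properties of the free space\<close>

text \<open>Metrizability enters through sequences: a failure of equicontinuity at \<open>x\<close> shows on the differences
  \<open>i y\<^sub>k - i x\<close> for some sequence \<open>y\<^sub>k\<close> tending to \<open>x\<close>, and these differences form a bounded set.\<close>

lemma free_lcs_metrizable_c0_quasibarrelled:
  assumes X: "metrizable_space X" and free: "free_lcs X L i"
  shows "c0_quasibarrelled L"
  unfolding c0_quasibarrelled_def
proof (intro allI impI, elim conjE)
  obtain M d where "Metric_space M d" and X: "X = Metric_space.mtopology M d"
    using X unfolding metrizable_space_def by blast
  interpret Metric_space M d by fact
  have L: "lcs L" and i: "continuous_map X L i" using free by (simp_all add: free_lcs_def)
  fix \<phi> assume \<phi>: "range \<phi> \<subseteq> dual L" and null: "limitin (strong_dual L) \<phi> 0 sequentially"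
  have lin: "linear (\<phi> n)" and cont: "continuous_map L euclideanreal (\<phi> n)" for n
    using \<phi> by (auto simp: dual_def)
  show "equicontinuous L (range \<phi>)"
  proof (rule free_lcs_equicontinuousI[OF free \<phi>])
    fix x assume x: "x \<in> topspace X"
    obtain N where N: "\<And>n. n \<ge> N \<Longrightarrow> \<bar>\<phi> n (i x)\<bar> \<le> 1"
      using strong_null_uniform[OF L null bounded_in_singleton[OF L, of "i x"], of 1] by auto
    have "\<bar>\<phi> n (i x)\<bar> \<le> 1 + (\<Sum>m<N. \<bar>\<phi> m (i x)\<bar>)" for n
    proof (cases "n < N")
      case True
      then have "\<bar>\<phi> n (i x)\<bar> \<le> (\<Sum>m<N. \<bar>\<phi> m (i x)\<bar>)" by (intro member_le_sum) auto
      then show ?thesis by simp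
    next
      case False
      then have "\<bar>\<phi> n (i x)\<bar> \<le> 1" by (intro N) simp
      moreover have "0 \<le> (\<Sum>m<N. \<bar>\<phi> m (i x)\<bar>)" by (intro sum_nonneg) simp
      ultimately show ?thesis by linarith
    qed
    then show "\<exists>r. \<forall>n. \<bar>\<phi> n (i x)\<bar> \<le> r" by blast
    fix e :: real assume e: "e > 0"
    show "\<exists>V. openin X V \<and> x \<in> V \<and> (\<forall>y\<in>V. \<forall>n. \<bar>\<phi> n (i y) - \<phi> n (i x)\<bar> \<le> e)"
    proof (rule ccontr)
      assume neg: "\<not> ?thesis"
      have "\<exists>y n. y \<in> mball x (inverse (real (Suc k))) \<and> \<bar>\<phi> n (i y) - \<phi> n (i x)\<bar> > e" for k :: nat
      proof -
        have "openin X (mball x (inverse (real (Suc k))))" "x \<in> mball x (inverse (real (Suc k)))"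
          using x by (auto simp: X)
        then show ?thesis using neg unfolding not_le[symmetric] by blast
      qed
      then obtain y n where y: "\<And>k. y k \<in> mball x (inverse (real (Suc k)))"
        and n: "\<And>k. \<bar>\<phi> (n k) (i (y k)) - \<phi> (n k) (i x)\<bar> > e" by metis
      define \<sigma> where "\<sigma> k = i (y k) - i x" for k
      have \<phi>\<sigma>: "\<phi> m (\<sigma> k) = \<phi> m (i (y k)) - \<phi> m (i x)" for m k
        by (simp add: \<sigma>_def linear_diff[OF lin])
      have yM: "y k \<in> M" and dy: "d (y k) x < inverse (real (Suc k))" for k
        using y[of k] commute[of "y k" x] by auto
      have "(\<lambda>k. d (y k) x) \<longlonglongrightarrow> 0"
        using less_imp_le[OF dy]
        by (intro tendsto_sandwich[OF always_eventually always_eventually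
              tendsto_const LIMSEQ_inverse_real_of_nat]) auto
      then have "limitin X y x sequentially"
        using yM x unfolding X by (simp add: limitin_metric_dist_null)
      moreover have "continuous_map X L (\<lambda>z. i z + (- i x))"
        by (intro lcs_continuous_add[OF L] i) (auto simp: lcs_topspace[OF L])
      ultimately have \<sigma>: "limitin L \<sigma> 0 sequentially"
        using continuous_map_limit[of X L "\<lambda>z. i z + (- i x)" y x sequentially]
        by (simp add: o_def \<sigma>_def[abs_def])
      \<comment> \<open>The bound is uniform in \<open>k\<close>, so every witness \<open>n k\<close> is below \<open>N\<close>.\<close>
      obtain N where N: "\<And>m k. m \<ge> N \<Longrightarrow> \<bar>\<phi> m (\<sigma> k)\<bar> \<le> e"
        using strong_null_uniform[OF L null bounded_in_null_sequence[OF L \<sigma>] e] by blast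
      have "eventually (\<lambda>k. \<bar>\<phi> m (\<sigma> k)\<bar> \<le> e) sequentially" for m
      proof -
        have "(\<lambda>k. \<phi> m (\<sigma> k)) \<longlonglongrightarrow> 0"
          using continuous_map_limit[OF cont \<sigma>, of m] by (simp add: o_def linear_0[OF lin])
        from tendstoD[OF this e] show ?thesis by (rule eventually_mono) simp
      qed
      then have "eventually (\<lambda>k. \<forall>m\<in>{..<N}. \<bar>\<phi> m (\<sigma> k)\<bar> \<le> e) sequentially"
        by (intro eventually_ball_finite) auto
      then obtain k where k: "\<forall>m\<in>{..<N}. \<bar>\<phi> m (\<sigma> k)\<bar> \<le> e" by (auto simp: eventually_sequentially)
      then have "\<bar>\<phi> (n k) (\<sigma> k)\<bar> \<le> e" using N by (cases "n k < N") auto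
      then show False using n[of k] by (simp add: \<phi>\<sigma>)
    qed
  qed
qed

theorem corollary1p3:
  fixes X :: "'x topology" and L :: "'v::real_vector topology" and i :: "'x \<Rightarrow> 'v"
  assumes "metrizable_space X"
    and "X \<noteq> discrete_topology (topspace X)"
    and "free_lcs X L i"
  shows "c0_quasibarrelled L \<and> \<not> c0_barrelled L \<and> \<not> linf_quasibarrelled L"
proof -
  note free = assms(3)
  have L: "lcs L" and i: "continuous_map X L i" using free by (simp_all add: free_lcs_def)
  obtain M d where "Metric_space M d" and X: "X = Metric_space.mtopology M d"
    using assms(1) unfolding metrizable_space_def by blast
  interpret Metric_space M d by fact
  obtain x where x: "x \<in> M" "\<not> openin mtopology {x}"
    using assms(2) discrete_topology_unique[of M X] by (auto simp: X)
  obtain f :: "nat \<Rightarrow> 'x \<Rightarrow> real" and p where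
    f: "\<And>n. continuous_map X euclideanreal (f n)" "\<And>n y. 0 \<le> f n y \<and> f n y \<le> 1"
      "\<And>y. y \<in> M \<Longrightarrow> (\<lambda>n. f n y) \<longlonglongrightarrow> 0" "\<And>n. f n x = 0" "\<And>n. f n (p n) = 1"
    and p: "limitin X p x sequentially"
    by (rule shrinking_bumps[OF x, folded X]) (rule that)
  have "\<exists>\<phi>\<in>dual L. \<forall>y\<in>topspace X. \<phi> (i y) = f n y" for n
  proof -
    obtain F where "linear F" "continuous_map L euclideanreal F" "\<And>y. y \<in> topspace X \<Longrightarrow> F (i y) = f n y"
      using free_lcs_extend[OF free lcs_euclidean f(1)[of n]] by metis
    then show ?thesis by (intro bexI[of _ F]) (simp_all add: dual_def)
  qed
  then obtain \<phi> where \<phi>: "\<And>n. \<phi> n \<in> dual L" "\<And>n y. y \<in> topspace X \<Longrightarrow> \<phi> n (i y) = f n y"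
    by metis
  have range: "range \<phi> \<subseteq> dual L" using \<phi>(1) by blast
  have not_equi: "\<not> equicontinuous L (range \<phi>)"
  proof
    assume "equicontinuous L (range \<phi>)"
    then obtain V where V: "openin X V" "x \<in> V" "\<forall>y\<in>V. \<forall>\<psi>\<in>range \<phi>. \<bar>\<psi> (i y) - \<psi> (i x)\<bar> \<le> 1 / 2"
      using equicontinuous_comp[OF L _ i, of "range \<phi>" x "1 / 2"] x(1) by (auto simp: X)
    then obtain n where "p n \<in> V" using p unfolding limitin_sequentially by blast
    then have "\<bar>\<phi> n (i (p n)) - \<phi> n (i x)\<bar> \<le> 1 / 2" "p n \<in> topspace X" "x \<in> topspace X"
      using V openin_subset[OF V(1)] by auto
    then show False by (simp add: \<phi>(2) f(4,5))
  qed
  have "limitin (weak_dual L) \<phi> 0 sequentially"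
    using f(3) by (intro free_lcs_weak_null[OF free range]) (simp add: \<phi>(2) X)
  then have "\<not> c0_barrelled L" using range not_equi unfolding c0_barrelled_def by blast
  moreover have "bounded_in (strong_dual L) (range \<phi>)"
    using f(2) by (intro free_lcs_uniformly_bounded_strong_bounded[OF free range, of 1])
      (simp add: \<phi>(2))
  then have "\<not> linf_quasibarrelled L" using range not_equi unfolding linf_quasibarrelled_def by blast
  ultimately show ?thesis
    using free_lcs_metrizable_c0_quasibarrelled[OF assms(1) free] by blast
qed

end
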